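(* Let $P=\mathbb{Z}[x_1,\dots,x_n]$, let $I\subseteq P$ be an ideal (given by finitely many generators) such that $R=P/I$ is a finite $\mathbb{Z}$-algebra, and let $\operatorname{Rad}(0)$ be the nilradical of $R$. The following sequence of instructions is an algorithm which computes a generating set of the unit group $R^\times$. 1. Let $G$ be the empty list. 2. Compute the nilradical $\operatorname{Rad}(0)$ of $R$. 3. Compute finitely many elements of $R$ whose residue classes generate the unit group of the reduced finite $\mathbb{Z}$-algebra $R/\operatorname{Rad}(0)$. Add these elements to $G$. 4. Compute the nilpotency index $s$ of $\operatorname{Rad}(0)$ in $R$. 5. For $i=2,\dots,s$: compute $f_1,\dots,f_\ell\in R$ such that the residue classes $\bar f_1,\dots,\bar f_\ell$ in $R/\operatorname{Rad}(0)^i$ generate the image of $1+\operatorname{Rad}(0)^{i-1}$ in $(R/\operatorname{Rad}(0)^i)^\times$, and add $f_1,\dots,f_\ell$ to $G$. 6. Return $G$. That is, whatever valid choices are made in the individual steps, the returned list $G$ is finite, consists of units of $R$, and generates the group $R^\times$.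
   Context: A finite $\mathbb{Z}$-algebra is a commutative ring (with 1) whose additive group is a finitely generated $\mathbb{Z}$-module. $R^\times$ denotes the group of units of $R$. The nilpotency index of $\operatorname{Rad}(0)$ is the smallest integer $s\ge 1$ with $\operatorname{Rad}(0)^s=0$. *)

theory Defs
  imports "HOL-Algebra.Algebra" "HOL-Library.Poly_Mapping"
begin

text \<open>The ring \<open>\<int>[x\<^sub>1, \<dots>, x\<^sub>n]\<close>. A monomial is a finitely supported exponent vector
  \<open>nat \<Rightarrow>\<^sub>0 nat\<close>, a polynomial a finitely supported map from monomials to integers, and
  multiplication of \<^typ>\<open>(nat \<Rightarrow>\<^sub>0 nat) \<Rightarrow>\<^sub>0 int\<close> is convolution. The type itself has a variable
  for each natural number; the carrier keeps the polynomials in the variables \<open>1, \<dots>, n\<close>.\<close>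

definition int_mpoly_ring :: "nat \<Rightarrow> ((nat \<Rightarrow>\<^sub>0 nat) \<Rightarrow>\<^sub>0 int) ring" where
  "int_mpoly_ring n =
    \<lparr>carrier = {p. \<forall>m \<in> Poly_Mapping.keys p. Poly_Mapping.keys m \<subseteq> {1..n}},
     monoid.mult = (\<lambda>p q. p * q), one = 1, ring.zero = 0, add = (\<lambda>p q. p + q)\<rparr>"

lemma int_mpoly_ring_cring: "cring (int_mpoly_ring n)"
proof (rule cringI)
  show "abelian_group (int_mpoly_ring n)"
  proof (rule abelian_groupI)
    fix p q assume "p \<in> carrier (int_mpoly_ring n)" "q \<in> carrier (int_mpoly_ring n)"
    then show "p \<oplus>\<^bsub>int_mpoly_ring n\<^esub> q \<in> carrier (int_mpoly_ring n)"
      using Poly_Mapping.keys_add[of p q] by (fastforce simp: int_mpoly_ring_def)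
  next
    fix p assume "p \<in> carrier (int_mpoly_ring n)"
    then show "\<exists>q\<in>carrier (int_mpoly_ring n). q \<oplus>\<^bsub>int_mpoly_ring n\<^esub> p = \<zero>\<^bsub>int_mpoly_ring n\<^esub>"
      by (intro bexI[of _ "- p"]) (auto simp: int_mpoly_ring_def)
  qed (auto simp: int_mpoly_ring_def algebra_simps)
next
  show "Group.comm_monoid (int_mpoly_ring n)"
  proof (rule comm_monoidI)
    fix p q assume pq: "p \<in> carrier (int_mpoly_ring n)" "q \<in> carrier (int_mpoly_ring n)"
    show "p \<otimes>\<^bsub>int_mpoly_ring n\<^esub> q \<in> carrier (int_mpoly_ring n)"
      unfolding int_mpoly_ring_def
    proof (simp, intro ballI)
      fix m assume "m \<in> Poly_Mapping.keys (p * q)"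
      then obtain a b where "m = a + b" "a \<in> Poly_Mapping.keys p" "b \<in> Poly_Mapping.keys q"
        using Poly_Mapping.keys_mult[of p q] by blast
      then show "Poly_Mapping.keys m \<subseteq> {Suc 0..n}"
        using pq Poly_Mapping.keys_add[of a b] by (fastforce simp: int_mpoly_ring_def)
    qed
  qed (auto simp: int_mpoly_ring_def algebra_simps)
qed (auto simp: int_mpoly_ring_def algebra_simps)

definition finite_Z_algebra :: "('a, 'b) ring_scheme \<Rightarrow> bool" where
  "finite_Z_algebra R \<longleftrightarrow>
    cring R \<and> (\<exists>B. finite B \<and> B \<subseteq> carrier R \<and> generate (add_monoid R) B = carrier R)"

definition nilradical :: "('a, 'b) ring_scheme \<Rightarrow> 'a set" where
  "nilradical R = {x \<in> carrier R. \<exists>k::nat. x [^]\<^bsub>R\<^esub> k = \<zero>\<^bsub>R\<^esub>}"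

primrec ideal_power :: "('a, 'b) ring_scheme \<Rightarrow> 'a set \<Rightarrow> nat \<Rightarrow> 'a set" where
  "ideal_power R J 0 = carrier R"
| "ideal_power R J (Suc k) = ideal_prod R (ideal_power R J k) J"

text \<open>Only meaningful if \<open>J\<close> is a nilpotent ideal.\<close>

definition nilpotency_index :: "('a, 'b) ring_scheme \<Rightarrow> 'a set \<Rightarrow> nat" where
  "nilpotency_index R J = (LEAST s. 1 \<le> s \<and> ideal_power R J s = {\<zero>\<^bsub>R\<^esub>})"

text \<open>The list \<open>fs\<close> consists of elements of \<open>R\<close> whose residue classes modulo \<open>J\<close> are units of
  \<open>R/J\<close> and generate the subgroup \<open>H\<close> of \<open>(R/J)\<^sup>\<times>\<close>.\<close>

definition residues_generate ::
    "('a, 'b) ring_scheme \<Rightarrow> 'a set \<Rightarrow> 'a list \<Rightarrow> 'a set set \<Rightarrow> bool" where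
  "residues_generate R J fs H \<longleftrightarrow>
    set fs \<subseteq> carrier R \<and>
    (\<lambda>f. J +>\<^bsub>R\<^esub> f) ` set fs \<subseteq> Units (R Quot J) \<and>
    generate (units_of (R Quot J)) ((\<lambda>f. J +>\<^bsub>R\<^esub> f) ` set fs) = H"

text \<open>\<open>G\<close> is a list that the algorithm may return on \<open>R\<close>: it consists of a valid choice \<open>us\<close> of
  lifts of generators of the unit group of \<open>R/Rad(0)\<close>, followed by valid choices \<open>fs i\<close> made in
  the passes \<open>i = 2, \<dots>, s\<close> through the loop (none if \<open>s = 1\<close>).\<close>

definition unit_group_algorithm_returns :: "('a, 'b) ring_scheme \<Rightarrow> 'a list \<Rightarrow> bool" where
  "unit_group_algorithm_returns R G \<longleftrightarrow>
    (let N = nilradical R; s = nilpotency_index R N in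
      \<exists>us fs.
        residues_generate R N us (Units (R Quot N)) \<and>
        (\<forall>i \<in> {2..s}.
          residues_generate R (ideal_power R N i) (fs i)
            ((\<lambda>a. ideal_power R N i +>\<^bsub>R\<^esub> (\<one>\<^bsub>R\<^esub> \<oplus>\<^bsub>R\<^esub> a)) ` ideal_power R N (i - 1))) \<and>
        G = us @ concat (map fs [2..<Suc s]))"

end

theory Submission
  imports Defs
begin

text \<open>Write \<open>N\<close> for the nilradical of \<open>R\<close>. The unit group is filtered by the subgroups
  \<open>1 + N\<^sup>i\<close>: the quotient of \<open>R\<^sup>\<times>\<close> by \<open>1 + N\<close> is the unit group of \<open>R/N\<close>, because an element that is
  invertible modulo a nil ideal is invertible (\<open>unit_modulo_nil_ideal\<close>), and the pass \<open>i\<close> of the loop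
  provides generators of the image of \<open>1 + N\<^sup>i\<^sup>-\<^sup>1\<close> modulo \<open>N\<^sup>i\<close>. Words in the lifts therefore approximate
  any given unit modulo \<open>N\<close>, \<open>N\<^sup>2\<close>, and so on (\<open>units_generated_by_filtration\<close>, based on
  \<open>generate_units_lift\<close>), and the process ends at \<open>N\<^sup>s = 0\<close>.

  What makes it end is that \<open>N\<close> is nilpotent. As a subgroup of a finitely generated abelian
  group, \<open>N\<close> is generated by finitely many elements (\<open>finitely_generated_subgroup\<close>), all nilpotent.
  By the pigeonhole principle every product of sufficiently many of them is zero
  (\<open>nilpotent_monomials\<close>), and such products generate the powers of \<open>N\<close> (\<open>ideal_power_generated\<close>).
  Hence the nilpotency index is the least element of a nonempty set.\<close>

section \<open>Subgroups of finitely generated abelian groups\<close>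

lemma (in comm_group) generate_insert_decompose:
  assumes "b \<in> carrier G" "B \<subseteq> carrier G" "x \<in> generate G (insert b B)"
  shows "\<exists>k::int. \<exists>c \<in> generate G B. x = b [^] k \<otimes> c"
  using assms(3)
proof (induction rule: generate.induct)
  case one
  show ?case using assms by (intro exI[of _ 0] bexI[of _ \<one>]) (auto intro: generate.one)
next
  case (incl h)
  show ?case
  proof (cases "h = b")
    case True
    then show ?thesis using assms
      by (intro exI[of _ 1] bexI[of _ \<one>]) (auto intro: generate.one simp: int_pow_1)
  next
    case False
    then show ?thesis using assms incl
      by (intro exI[of _ 0] bexI[of _ h]) (auto intro: generate.incl)
  qed
next
  case (inv h)
  show ?case
  proof (cases "h = b")
    case True
    then show ?thesis using assms
      by (intro exI[of _ "-1"] bexI[of _ \<one>]) (auto intro: generate.one simp: int_pow_neg int_pow_1)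
  next
    case False
    then show ?thesis using assms inv
      by (intro exI[of _ 0] bexI[of _ "inv h"]) (auto intro: generate.inv)
  qed
next
  case (eng x y)
  then obtain k l :: int and c d where
    x: "x = b [^] k \<otimes> c" "c \<in> generate G B" and y: "y = b [^] l \<otimes> d" "d \<in> generate G B"
    by blast
  have "c \<in> carrier G" "d \<in> carrier G" using x y generate_in_carrier assms by blast+
  then have "x \<otimes> y = b [^] (k + l) \<otimes> (c \<otimes> d)"
    using x y assms by (simp add: int_pow_mult m_ac)
  then show ?case using x y generate.eng by metis
qed

text \<open>Induction on the number of generators. The exponents of the new generator \<open>b\<close> that occur in
  elements of \<open>H\<close> form an ideal of \<open>\<int>\<close>; an element of \<open>H\<close> realizing a generator \<open>d\<close> of that ideal,
  together with generators of \<open>H \<inter> \<langle>B\<rangle>\<close>, generates \<open>H\<close>.\<close>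

lemma (in comm_group) finitely_generated_subgroup:
  assumes "finite B" "B \<subseteq> carrier G" "subgroup H G" "H \<subseteq> generate G B"
  shows "\<exists>A. finite A \<and> A \<subseteq> H \<and> generate G A = H"
  using assms
proof (induction B arbitrary: H rule: finite_induct)
  case empty
  then have "generate G {} = H"
    using generate_empty subgroup.one_closed[of H G] by auto
  then show ?case by blast
next
  case (insert b B)
  have b: "b \<in> carrier G" and B: "B \<subseteq> carrier G" using insert by auto
  let ?gB = "generate G B"
  have gB: "subgroup ?gB G" using generate_is_subgroup[OF B] .
  have Hc: "H \<subseteq> carrier G" using insert.prems subgroup.subset by auto
  define S where "S = {k::int. k \<noteq> 0 \<and> (\<exists>c\<in>?gB. b [^] k \<otimes> c \<in> H)}"
  have sub: "H \<inter> ?gB \<subseteq> generate G B" "subgroup (H \<inter> ?gB) G"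
    using subgroups_Inter_pair[OF insert.prems(2) gB] by auto
  obtain Y where Y: "finite Y" "Y \<subseteq> H \<inter> ?gB" "generate G Y = H \<inter> ?gB"
    using insert.IH[OF B sub(2,1)] by blast
  show ?case
  proof (cases "S = {}")
    case True
    have "h \<in> ?gB" if h: "h \<in> H" for h
    proof -
      obtain k :: int and c where kc: "c \<in> ?gB" "h = b [^] k \<otimes> c"
        using generate_insert_decompose[OF b B] h insert.prems by blast
      then have "k = 0" using True h by (auto simp: S_def)
      moreover have "c \<in> carrier G" using kc generate_in_carrier[OF B] by blast
      ultimately show ?thesis using kc by simp
    qed
    then have "H \<inter> ?gB = H" by blast
    then show ?thesis using Y by auto
  next
    case False
    then obtain d where d: "d \<in> S" and dmin: "\<And>k. k \<in> S \<Longrightarrow> nat \<bar>d\<bar> \<le> nat \<bar>k\<bar>"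
      using ex_has_least_nat[of "\<lambda>k. k \<in> S" _ "\<lambda>k. nat \<bar>k\<bar>"] by blast
    obtain c0 where c0: "c0 \<in> ?gB" "b [^] d \<otimes> c0 \<in> H" using d by (auto simp: S_def)
    define h0 where "h0 = b [^] d \<otimes> c0"
    have c0c: "c0 \<in> carrier G" using c0 generate_in_carrier[OF B] by blast
    have h0c: "h0 \<in> carrier G" using b c0c by (simp add: h0_def)
    let ?K = "generate G (insert h0 Y)"
    have Xc: "insert h0 Y \<subseteq> carrier G" using h0c Y Hc by auto
    have K: "subgroup ?K G" using generate_is_subgroup[OF Xc] .
    have "h \<in> ?K" if h: "h \<in> H" for h
    proof -
      obtain k :: int and c where kc: "c \<in> ?gB" "h = b [^] k \<otimes> c"
        using generate_insert_decompose[OF b B] h insert.prems by blast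
      \<comment> \<open>Dividing by a power of \<open>h0\<close> reduces the exponent \<open>k\<close> modulo \<open>d\<close>; minimality of \<open>\<bar>d\<bar>\<close>
        then forces the remainder to vanish.\<close>
      define q where "q = k div d"
      define y where "y = h \<otimes> h0 [^] (- q)"
      have cc: "c \<in> carrier G" using kc generate_in_carrier[OF B] by blast
      have yH: "y \<in> H"
        unfolding y_def using h c0 insert.prems(2)
        by (metis h0_def subgroup.m_closed subgroup_int_pow_closed)
      define c' where "c' = c \<otimes> c0 [^] (- q)"
      have c': "c' \<in> ?gB"
        unfolding c'_def using kc c0 gB by (metis subgroup.m_closed subgroup_int_pow_closed)
      have c'c: "c' \<in> carrier G" using c' generate_in_carrier[OF B] by blast
      have e: "k + d * (- q) = k mod d" by (simp add: q_def minus_mult_div_eq_mod)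
      have "y = b [^] k \<otimes> c \<otimes> (b [^] (d * (- q)) \<otimes> c0 [^] (- q))"
        unfolding y_def h0_def kc(2) using b c0c
        by (simp only: int_pow_distrib int_pow_closed int_pow_pow)
      also have "\<dots> = b [^] (k + d * (- q)) \<otimes> c'"
        unfolding c'_def int_pow_mult[OF b] using b c0c cc by (simp add: m_ac del: mult_minus_right)
      finally have y: "y = b [^] (k mod d) \<otimes> c'" unfolding e .
      have "k mod d = 0"
      proof (rule ccontr)
        assume "k mod d \<noteq> 0"
        then have "k mod d \<in> S" using y yH c' by (auto simp: S_def)
        then have "\<bar>d\<bar> \<le> \<bar>k mod d\<bar>" using dmin by fastforce
        moreover have "d \<noteq> 0" using d by (auto simp: S_def)
        ultimately show False using abs_mod_less[of d k] by linarith
      qed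
      then have "y = c'" using y c'c by simp
      then have "y \<in> generate G Y" using yH c' Y by auto
      then have "y \<in> ?K" using mono_generate[of Y "insert h0 Y"] by blast
      moreover have "h0 [^] q \<in> ?K"
        by (rule subgroup_int_pow_closed[OF K]) (simp add: generate.incl)
      moreover have "y \<otimes> h0 [^] q = h \<otimes> (h0 [^] (- q) \<otimes> h0 [^] q)"
        unfolding y_def using h Hc h0c by (intro m_assoc) auto
      then have "h = y \<otimes> h0 [^] q"
        using h Hc int_pow_mult[OF h0c, of "- q" q, symmetric] by (simp add: subset_iff)
      ultimately show ?thesis using generate.eng by metis
    qed
    moreover have "?K \<subseteq> H"
      using generate_subgroup_incl[OF _ insert.prems(2), of "insert h0 Y"] Y c0 h0_def by auto
    ultimately have "?K = H" by blast
    then show ?thesis using Y c0 h0_def by (intro exI[of _ "insert h0 Y"]) auto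
  qed
qed

section \<open>Nilpotency of the nilradical\<close>

text \<open>The elements multiplying \<open>a\<close> into \<open>K\<close> form an ideal. This turns the statement that a product
  of two generated ideals lies in \<open>K\<close> into a statement about generators, one factor at a time.\<close>

lemma (in cring) colon_ideal:
  assumes K: "ideal K R" and a: "a \<in> carrier R"
  shows "ideal {x \<in> carrier R. x \<otimes> a \<in> K} R"
proof -
  interpret K: ideal K R by fact
  show ?thesis
  proof (rule idealI)
    show "subgroup {x \<in> carrier R. x \<otimes> a \<in> K} (add_monoid R)"
      by (rule add.subgroupI) (use a in \<open>auto simp: l_distr l_minus a_inv_def[symmetric] intro!: exI[of _ \<zero>]\<close>)
  next
    fix x y assume x: "x \<in> {x \<in> carrier R. x \<otimes> a \<in> K}" and y: "y \<in> carrier R"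
    then show "y \<otimes> x \<in> {x \<in> carrier R. x \<otimes> a \<in> K}" using a K.I_l_closed by (simp add: m_assoc)
    then show "x \<otimes> y \<in> {x \<in> carrier R. x \<otimes> a \<in> K}" using x y by (simp add: m_comm)
  qed (rule ring_axioms)
qed

text \<open>The degree \<open>k\<close> products of elements of \<open>A\<close>, recorded by their exponents so that the pigeonhole
  principle can be applied. An infinite \<open>A\<close> would give only \<open>\<one>\<close>, and only for \<open>k = 0\<close>.\<close>

definition monomials :: "('a, 'b) ring_scheme \<Rightarrow> 'a set \<Rightarrow> nat \<Rightarrow> 'a set" where
  "monomials R A k = {\<Otimes>\<^bsub>R\<^esub>x\<in>A. x [^]\<^bsub>R\<^esub> e x | e :: 'a \<Rightarrow> nat. sum e A = k}"

lemma (in cring) monomials_closed: "A \<subseteq> carrier R \<Longrightarrow> monomials R A k \<subseteq> carrier R"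
  by (auto simp: monomials_def intro!: finprod_closed)

lemma (in cring) monomials_0: "\<one> \<in> monomials R A 0"
  unfolding monomials_def by (force intro!: exI[of _ "\<lambda>_. 0"])

lemma (in cring) monomials_Suc:
  assumes A: "finite A" "A \<subseteq> carrier R" and m: "m \<in> monomials R A k" and y: "y \<in> A"
  shows "m \<otimes> y \<in> monomials R A (Suc k)"
proof -
  obtain e :: "'a \<Rightarrow> nat" where e: "m = (\<Otimes>x\<in>A. x [^] e x)" "sum e A = k"
    using m by (auto simp: monomials_def)
  let ?i = "\<lambda>x. if x = y then 1 else 0 :: nat"
  have "(\<Otimes>x\<in>A. x [^] ?i x) = (\<Otimes>x\<in>A. if y = x then x else \<one>)"
    using A by (intro finprod_cong') auto
  also have "\<dots> = y" using A y finprod_singleton[of y A "\<lambda>x. x"] by auto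
  finally have "m \<otimes> y = (\<Otimes>x\<in>A. x [^] e x) \<otimes> (\<Otimes>x\<in>A. x [^] ?i x)" using e by simp
  also have "\<dots> = (\<Otimes>x\<in>A. x [^] e x \<otimes> x [^] ?i x)"
    using A by (intro finprod_multf[symmetric]) auto
  also have "\<dots> = (\<Otimes>x\<in>A. x [^] (e x + ?i x))"
    using A by (intro finprod_cong') (auto simp: nat_pow_mult)
  finally have "m \<otimes> y = (\<Otimes>x\<in>A. x [^] (e x + ?i x))" .
  moreover have "(\<Sum>x\<in>A. e x + ?i x) = Suc k" using A y e by (simp add: sum.distrib)
  ultimately show ?thesis unfolding monomials_def by (intro CollectI exI[of _ "\<lambda>x. e x + ?i x"]) simp
qed

text \<open>Pigeonhole: if each \<open>x \<in> A\<close> satisfies \<open>x [^] d x = \<zero>\<close>, a monomial of degree larger than the sum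
  of the \<open>d x\<close> has an exponent \<open>e y \<ge> d y\<close>.\<close>

lemma (in cring) nilpotent_monomials:
  assumes A: "finite A" "A \<subseteq> nilradical R"
  shows "\<exists>k. monomials R A k \<subseteq> {\<zero>}"
proof -
  have Ac: "A \<subseteq> carrier R" using A by (auto simp: nilradical_def)
  have "\<forall>x\<in>A. \<exists>n::nat. x [^] n = \<zero>" using A by (auto simp: nilradical_def)
  then obtain d :: "'a \<Rightarrow> nat" where d: "\<And>x. x \<in> A \<Longrightarrow> x [^] d x = \<zero>" by metis
  have "m = \<zero>" if m: "m \<in> monomials R A (Suc (sum d A))" for m
  proof -
    obtain e :: "'a \<Rightarrow> nat" where e: "m = (\<Otimes>x\<in>A. x [^] e x)" "sum e A = Suc (sum d A)"
      using m by (auto simp: monomials_def)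
    obtain y where y: "y \<in> A" "d y \<le> e y"
      using e(2) sum_mono[of A e d] by (metis not_less_eq_eq nat_le_linear order_refl)
    have "y [^] e y = y [^] d y \<otimes> y [^] (e y - d y)"
      using y Ac by (subst nat_pow_mult) auto
    then have "y [^] e y = \<zero>" using y d Ac by (simp add: subset_iff)
    moreover have "(\<Otimes>x\<in>A. x [^] e x) = y [^] e y \<otimes> (\<Otimes>x\<in>A - {y}. x [^] e x)"
      using finprod_insert[of "A - {y}" y "\<lambda>x. x [^] e x"] A(1) y Ac
      by (auto simp: insert_absorb Pi_def subset_iff)
    ultimately show ?thesis using e(1) Ac by (simp add: subset_iff)
  qed
  then show ?thesis by blast
qed

lemma (in cring) ideal_power_is_ideal: "ideal J R \<Longrightarrow> ideal (ideal_power R J k) R"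
  by (induction k) (auto simp: oneideal ideal_prod_is_ideal)

lemma (in cring) ideal_power_one: "ideal J R \<Longrightarrow> ideal_power R J 1 = J"
  using ideal_prod_commute[OF oneideal, of J] ideal_prod_one[of J] by simp

lemma (in cring) ideal_power_subset: "ideal J R \<Longrightarrow> k \<ge> 1 \<Longrightarrow> ideal_power R J k \<subseteq> J"
  using ideal_prod_inter[OF ideal_power_is_ideal, of J J] by (cases k) auto

lemma (in cring) ideal_power_generated:
  assumes A: "finite A" "A \<subseteq> carrier R"
  shows "ideal_power R (Idl A) k \<subseteq> Idl (monomials R A k)"
proof (induction k)
  case 0
  have "ideal (Idl (monomials R A 0)) R" using genideal_ideal monomials_closed A by blast
  moreover have "\<one> \<in> Idl (monomials R A 0)"
    using genideal_self monomials_0 monomials_closed A by blast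
  ultimately show ?case using ideal.one_imp_carrier by fastforce
next
  case (Suc k)
  let ?K = "Idl (monomials R A (Suc k))"
  have K: "ideal ?K R" using genideal_ideal monomials_closed A by blast
  interpret K: ideal ?K R by fact
  have monK: "m \<otimes> y \<in> ?K" if "m \<in> monomials R A k" "y \<in> A" for m y
    using monomials_Suc[OF A that] genideal_self monomials_closed A(2) by blast
  have 1: "i \<otimes> y \<in> ?K" if i: "i \<in> Idl (monomials R A k)" and y: "y \<in> A" for i y
  proof -
    have "y \<in> carrier R" using y A by blast
    then have "Idl (monomials R A k) \<subseteq> {x \<in> carrier R. x \<otimes> y \<in> ?K}"
      using monK y monomials_closed[OF A(2)] by (intro genideal_minimal colon_ideal K) blast+
    then show ?thesis using i by blast
  qed
  have 2: "i \<otimes> j \<in> ?K" if i: "i \<in> Idl (monomials R A k)" and j: "j \<in> Idl A" for i j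
  proof -
    have ic: "i \<in> carrier R"
      using i ideal.Icarr[OF genideal_ideal[OF monomials_closed[OF A(2)]]] by blast
    have "Idl A \<subseteq> {x \<in> carrier R. x \<otimes> i \<in> ?K}"
    proof (intro genideal_minimal colon_ideal K ic subsetI)
      fix y assume y: "y \<in> A"
      then have "y \<in> carrier R" using A by blast
      then show "y \<in> {x \<in> carrier R. x \<otimes> i \<in> ?K}" using 1[OF i y] ic by (simp add: m_comm)
    qed
    then show ?thesis using j ic m_comm[of i j] by auto
  qed
  show ?case
  proof
    fix z assume "z \<in> ideal_power R (Idl A) (Suc k)"
    then have "z \<in> ideal_prod R (ideal_power R (Idl A) k) (Idl A)" by simp
    then show "z \<in> ?K" by induction (use 2 Suc in auto)
  qed
qed

lemma (in cring) finitely_generated_nil_ideal_nilpotent: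
  assumes A: "finite A" "A \<subseteq> nilradical R"
  shows "\<exists>s. ideal_power R (Idl A) s \<subseteq> {\<zero>}"
proof -
  obtain k where k: "monomials R A k \<subseteq> {\<zero>}" using nilpotent_monomials A by blast
  have "A \<subseteq> carrier R" using A by (auto simp: nilradical_def)
  then show ?thesis
    using ideal_power_generated[OF A(1), of k] genideal_minimal[OF zeroideal k] by blast
qed

lemma (in cring) nat_pow_in_ideal_power:
  assumes "ideal J R" "x \<in> J"
  shows "x [^] (k::nat) \<in> ideal_power R J k"
  using assms by (induction k) (auto intro: ideal_prod.prod)

text \<open>For the sum of nilpotent elements \<open>x\<close> and \<open>y\<close> no binomial expansion is needed: \<open>x \<oplus> y\<close> lies in
  the ideal generated by \<open>x\<close> and \<open>y\<close>, some power of which is zero.\<close>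

lemma (in cring) nilradical_ideal: "ideal (nilradical R) R"
proof -
  have mult: "y \<otimes> x \<in> nilradical R" if xy: "x \<in> nilradical R" "y \<in> carrier R" for x y
  proof -
    obtain k :: nat where "x \<in> carrier R" "x [^] k = \<zero>"
      using xy by (auto simp: nilradical_def)
    then have "(y \<otimes> x) [^] k = \<zero>" using xy by (simp add: nat_pow_distrib)
    then show ?thesis using xy by (auto simp: nilradical_def)
  qed
  have add: "x \<oplus> y \<in> nilradical R" if xy: "x \<in> nilradical R" "y \<in> nilradical R" for x y
  proof -
    let ?A = "{x, y}"
    have c: "?A \<subseteq> carrier R" using xy by (auto simp: nilradical_def)
    interpret I: ideal "Idl ?A" R by (rule genideal_ideal[OF c])
    obtain s where s: "ideal_power R (Idl ?A) s \<subseteq> {\<zero>}"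
      using finitely_generated_nil_ideal_nilpotent[of ?A] xy by auto
    have "x \<oplus> y \<in> Idl ?A" using genideal_self[OF c] by auto
    then have "(x \<oplus> y) [^] s \<in> ideal_power R (Idl ?A) s"
      using nat_pow_in_ideal_power I.ideal_axioms by blast
    then show ?thesis using s c by (auto simp: nilradical_def)
  qed
  show ?thesis
  proof (rule idealI)
    show "subgroup (nilradical R) (add_monoid R)"
    proof (rule add.subgroupI)
      show "\<ominus> x \<in> nilradical R" if "x \<in> nilradical R" for x
        using mult[OF that, of "\<ominus> \<one>"] that
        by (simp add: nilradical_def l_minus)
    next
      have "\<zero> [^] (1::nat) = \<zero>" by simp
      then have "\<zero> \<in> nilradical R" unfolding nilradical_def by blast
      then show "nilradical R \<noteq> {}" by blast
    qed (use add in \<open>auto simp: nilradical_def\<close>)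
  next
    fix x y assume "x \<in> nilradical R" "y \<in> carrier R"
    with mult show "y \<otimes> x \<in> nilradical R" by blast
    then show "x \<otimes> y \<in> nilradical R"
      using \<open>x \<in> nilradical R\<close> \<open>y \<in> carrier R\<close> by (simp add: m_comm nilradical_def)
  qed (rule ring_axioms)
qed

text \<open>The nilradical is a subgroup of the finitely generated additive group of \<open>R\<close>, hence finitely
  generated, and an ideal generated by finitely many nilpotent elements is nilpotent.\<close>

lemma (in cring) nilradical_nilpotent:
  assumes "finite_Z_algebra R"
  shows "\<exists>s\<ge>1. ideal_power R (nilradical R) s = {\<zero>}"
proof -
  interpret N: ideal "nilradical R" R by (rule nilradical_ideal)
  obtain B where "finite B" "B \<subseteq> carrier R" "generate (add_monoid R) B = carrier R"
    using assms by (auto simp: finite_Z_algebra_def)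
  then obtain A where A: "finite A" "A \<subseteq> nilradical R" "generate (add_monoid R) A = nilradical R"
    using comm_group.finitely_generated_subgroup[OF a_comm_group, of B "nilradical R"]
      N.a_subgroup N.a_subset by auto
  have Ac: "A \<subseteq> carrier R" using A N.a_subset by blast
  interpret I: ideal "Idl A" R by (rule genideal_ideal[OF Ac])
  have "nilradical R \<subseteq> Idl A"
    using add.generate_subgroup_incl[OF genideal_self[OF Ac] I.a_subgroup] A by simp
  moreover have "Idl A \<subseteq> nilradical R" using genideal_minimal[OF nilradical_ideal A(2)] .
  ultimately have NA: "nilradical R = Idl A" by blast
  obtain k where "ideal_power R (nilradical R) k \<subseteq> {\<zero>}"
    using finitely_generated_nil_ideal_nilpotent[OF A(1,2)] NA by auto
  then have "ideal_power R (nilradical R) k = {\<zero>}"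
    using additive_subgroup.zero_closed[OF ideal.axioms(1)[OF ideal_power_is_ideal[OF nilradical_ideal, of k]]] by blast
  \<comment> \<open>Passing to \<open>Suc k\<close> guarantees a positive exponent: if \<open>R\<close> is the zero ring, \<open>k\<close> may be \<open>0\<close>.\<close>
  then have "ideal_power R (nilradical R) (Suc k) = {\<zero>}"
    using ideal_prod_commute[OF zeroideal nilradical_ideal] ideal_prod_zero[OF nilradical_ideal] by simp
  then show ?thesis by (intro exI[of _ "Suc k"]) simp
qed

section \<open>Units modulo nil ideals\<close>

text \<open>The inverse is the geometric series in \<open>a\<close>, which terminates. Its partial sums are built up in
  the inner induction.\<close>

lemma (in cring) one_minus_nilpotent_unit:
  assumes "a \<in> nilradical R"
  shows "\<one> \<ominus> a \<in> Units R"
proof -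
  obtain k :: nat where a: "a \<in> carrier R" "a [^] k = \<zero>"
    using assms by (auto simp: nilradical_def)
  have "\<exists>b\<in>carrier R. (\<one> \<ominus> a) \<otimes> b = \<one> \<ominus> a [^] j" for j :: nat
  proof (induction j)
    case 0
    show ?case using a by (intro bexI[of _ \<zero>]) (simp_all, algebra)
  next
    case (Suc j)
    then obtain b where b: "b \<in> carrier R" "(\<one> \<ominus> a) \<otimes> b = \<one> \<ominus> a [^] j" by blast
    have "(\<one> \<ominus> a) \<otimes> (b \<oplus> a [^] j) = (\<one> \<ominus> a) \<otimes> b \<oplus> (\<one> \<ominus> a) \<otimes> a [^] j"
      using a b by (simp add: r_distr)
    also have "\<dots> = \<one> \<ominus> a [^] j \<otimes> a"
      unfolding b(2) using a(1) nat_pow_closed[OF a(1), of j] by algebra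
    finally show ?case using a b by (intro bexI[of _ "b \<oplus> a [^] j"]) simp_all
  qed
  then obtain b where "b \<in> carrier R" "(\<one> \<ominus> a) \<otimes> b = \<one> \<ominus> \<zero>" using a(2) by metis
  then have "b \<in> carrier R" "(\<one> \<ominus> a) \<otimes> b \<in> Units R" by (simp_all add: a_minus_def)
  then show ?thesis using unit_factor[of "\<one> \<ominus> a" b] a by blast
qed

text \<open>If \<open>g\<close> represents an inverse of \<open>f\<close> modulo \<open>J\<close>, then \<open>f \<otimes> g\<close> differs from \<open>\<one>\<close> by a nilpotent
  element, hence is itself a unit. This is why arbitrary lifts of units may be put in the list.\<close>

lemma (in cring) unit_modulo_nil_ideal:
  assumes J: "ideal J R" "J \<subseteq> nilradical R" and f: "f \<in> carrier R"
    and u: "J +> f \<in> Units (R Quot J)"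
  shows "f \<in> Units R"
proof -
  interpret J: ideal J R by fact
  obtain G where "G \<in> carrier (R Quot J)" "(J +> f) \<otimes>\<^bsub>R Quot J\<^esub> G = \<one>\<^bsub>R Quot J\<^esub>"
    using u by (auto simp: Units_def)
  then obtain g where g: "g \<in> carrier R" "(J +> f) \<otimes>\<^bsub>R Quot J\<^esub> (J +> g) = J +> \<one>"
    by (auto simp: FactRing_def A_RCOSETS_def' )
  then have "J +> \<one> = J +> (f \<otimes> g)" using f by (simp add: FactRing_def J.rcoset_mult_add)
  then have "\<one> \<ominus> f \<otimes> g \<in> J" using f g quotient_eq_iff_same_a_r_cos[OF J(1), of \<one> "f \<otimes> g"] by simp
  then have "\<one> \<ominus> (\<one> \<ominus> f \<otimes> g) \<in> Units R" using one_minus_nilpotent_unit J by blast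
  moreover have "\<one> \<ominus> (\<one> \<ominus> f \<otimes> g) = f \<otimes> g" using f g by algebra
  ultimately have "f \<otimes> g \<in> Units R" by (simp only:)
  then show ?thesis using unit_factor f g by blast
qed

text \<open>The residue map restricts to a group homomorphism of unit groups, and homomorphisms commute
  with taking the generated subgroup. So a congruence class known to lie in the subgroup generated
  by residues is represented by an actual word in the lifts.\<close>

lemma (in cring) generate_units_lift:
  assumes J: "ideal J R" and A: "A \<subseteq> Units R"
  shows "generate (units_of (R Quot J)) ((+>) J ` A) = (+>) J ` generate (units_of R) A"
proof -
  interpret J: ideal J R by fact
  interpret h: ring_hom_cring R "R Quot J" "(+>) J" using J.rcos_ring_hom_cring is_cring by blast
  have "(+>) J \<in> hom (units_of R) (units_of (R Quot J))"
    unfolding hom_def units_of_carrier units_of_mult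
    using Units_inv_closed
    by (auto simp: Units_def) (metis h.hom_closed h.hom_mult h.hom_one)
  then interpret g: group_hom "units_of R" "units_of (R Quot J)" "(+>) J"
    by (intro group_hom.intro group_hom_axioms.intro units_group h.S.units_group)
  show ?thesis using g.generate_img A by (simp add: units_of_carrier)
qed

section \<open>Successive approximation of units\<close>

lemma (in cring) residues_generate_nil_ideal:
  assumes J: "ideal J R" "J \<subseteq> nilradical R" and fs: "residues_generate R J fs H"
  shows "set fs \<subseteq> Units R" and "H = (+>) J ` generate (units_of R) (set fs)"
proof -
  show *: "set fs \<subseteq> Units R"
    using fs unit_modulo_nil_ideal[OF J] by (auto simp: residues_generate_def)
  show "H = (+>) J ` generate (units_of R) (set fs)"
    using fs generate_units_lift[OF J(1) *] by (simp add: residues_generate_def)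
qed

text \<open>Successive approximation. A unit \<open>u\<close> is congruent modulo the nilradical to a word in \<open>us\<close>. If
  \<open>u\<close> is congruent to \<open>h\<close> modulo the \<open>k\<close>-th power, then \<open>u = h \<otimes> (\<one> \<oplus> a)\<close> with \<open>a\<close> in that power, and
  \<open>\<one> \<oplus> a\<close> is congruent modulo the next power to a word in \<open>fs (k + 1)\<close>. At the \<open>s\<close>-th power the
  congruence is an equality.\<close>

lemma (in cring) units_generated_by_filtration:
  fixes s :: nat
  assumes nil: "ideal_power R (nilradical R) s = {\<zero>}" and s: "1 \<le> s"
    and us: "residues_generate R (nilradical R) us (Units (R Quot nilradical R))"
    and fs: "\<And>i. 2 \<le> i \<Longrightarrow> i \<le> s \<Longrightarrow>
      residues_generate R (ideal_power R (nilradical R) i) (fs i)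
        ((\<lambda>a. ideal_power R (nilradical R) i +> (\<one> \<oplus> a)) ` ideal_power R (nilradical R) (i - 1))"
  defines "A \<equiv> set us \<union> (\<Union>i\<in>{2..s}. set (fs i))"
  shows "A \<subseteq> Units R" and "generate (units_of R) A = Units R"
proof -
  let ?N = "nilradical R"
  let ?P = "ideal_power R ?N"
  let ?H = "generate (units_of R) A"
  have P: "ideal (?P i) R" for i by (rule ideal_power_is_ideal[OF nilradical_ideal])
  have PN: "?P i \<subseteq> ?N" if "1 \<le> i" for i by (rule ideal_power_subset[OF nilradical_ideal that])
  note us' = residues_generate_nil_ideal[OF nilradical_ideal order_refl us]
  have fs': "set (fs i) \<subseteq> Units R"
    "(\<lambda>a. ?P i +> (\<one> \<oplus> a)) ` ?P (i - 1) = (+>) (?P i) ` generate (units_of R) (set (fs i))"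
    if "2 \<le> i" "i \<le> s" for i
    using residues_generate_nil_ideal[OF P PN fs[OF that]] that by auto
  show AU: "A \<subseteq> Units R" unfolding A_def using us'(1) fs'(1) by (simp add: UN_subset_iff)
  interpret U: group "units_of R" by (rule units_group)
  have HU: "?H \<subseteq> Units R" using U.generate_incl[of A] AU by (simp add: units_of_carrier)
  have approx: "\<exists>h\<in>?H. u \<ominus> h \<in> ?P k" if "1 \<le> k" "k \<le> s" and u: "u \<in> Units R" for k u
    using that(1,2)
  proof (induction k rule: nat_induct_at_least)
    case base
    interpret N: ideal ?N R by (rule nilradical_ideal)
    interpret h: ring_hom_cring R "R Quot ?N" "(+>) ?N" using N.rcos_ring_hom_cring is_cring by blast
    have "?N +> u \<in> Units (R Quot ?N)"
      using u by (auto simp: Units_def) (metis h.hom_closed h.hom_mult h.hom_one)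
    then obtain h where h: "h \<in> generate (units_of R) (set us)" "?N +> u = ?N +> h"
      using us'(2) by auto
    have "h \<in> ?H" using h U.mono_generate[of "set us" A] by (auto simp: A_def)
    moreover have "u \<ominus> h \<in> ?N"
      using h(2) quotient_eq_iff_same_a_r_cos[OF nilradical_ideal, of u h] u HU \<open>h \<in> ?H\<close> by auto
    ultimately show ?case using ideal_power_one[OF nilradical_ideal] by auto
  next
    case (Suc k)
    then obtain h where h: "h \<in> ?H" "u \<ominus> h \<in> ?P k" by auto
    have hU: "h \<in> Units R" using h HU by auto
    interpret Pk: ideal "?P k" R by (rule P)
    interpret Pk': ideal "?P (Suc k)" R by (rule P)
    \<comment> \<open>The relative error of the approximation \<open>h\<close> to \<open>u\<close>.\<close>
    define a where "a = inv h \<otimes> (u \<ominus> h)"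
    have a: "a \<in> ?P k" unfolding a_def using h hU by (intro Pk.I_l_closed) auto
    have ac: "a \<in> carrier R" using a by auto
    have ha: "h \<otimes> (\<one> \<oplus> a) = u"
    proof -
      have "h \<otimes> (\<one> \<oplus> a) = h \<oplus> (h \<otimes> inv h) \<otimes> (u \<ominus> h)"
        unfolding a_def using hU u by (simp add: r_distr m_assoc[symmetric] Units_closed)
      also have "\<dots> = h \<oplus> (u \<ominus> h)"
        unfolding Units_r_inv[OF hU] using hU u by (simp add: Units_closed)
      also have "\<dots> = u" using Units_closed[OF hU] Units_closed[OF u] by algebra
      finally show ?thesis .
    qed
    have i: "2 \<le> Suc k" "Suc k \<le> s" using Suc by auto
    have "?P (Suc k) +> (\<one> \<oplus> a) \<in> (+>) (?P (Suc k)) ` generate (units_of R) (set (fs (Suc k)))"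
      using fs'(2)[OF i] a by auto
    then obtain g where g: "g \<in> generate (units_of R) (set (fs (Suc k)))"
      "?P (Suc k) +> (\<one> \<oplus> a) = ?P (Suc k) +> g" by auto
    have "Suc k \<in> {2..s}" using i by simp
    then have "set (fs (Suc k)) \<subseteq> A" unfolding A_def by blast
    then have gH: "g \<in> ?H" using g(1) U.mono_generate by blast
    have gc: "g \<in> carrier R" and hc: "h \<in> carrier R" using gH HU hU by auto
    have "(\<one> \<oplus> a) \<ominus> g \<in> ?P (Suc k)"
      using g(2) quotient_eq_iff_same_a_r_cos[OF P, of "\<one> \<oplus> a" g "Suc k"] ac gc
      by (simp del: ideal_power.simps)
    then have "h \<otimes> ((\<one> \<oplus> a) \<ominus> g) \<in> ?P (Suc k)" using hc by (rule Pk'.I_l_closed)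
    moreover have "h \<otimes> ((\<one> \<oplus> a) \<ominus> g) = h \<otimes> (\<one> \<oplus> a) \<ominus> h \<otimes> g" using ac gc hc by algebra
    moreover have "h \<otimes> g \<in> ?H" using generate.eng[OF h(1) gH] by (simp add: units_of_mult)
    ultimately show ?case unfolding ha by (metis (no_types))
  qed
  have "u \<in> ?H" if u: "u \<in> Units R" for u
  proof -
    obtain h where h: "h \<in> ?H" "u \<ominus> h = \<zero>" using approx[OF s order_refl u] nil by auto
    then have "u = h" using r_right_minus_eq[of u h] u HU by auto
    with h show ?thesis by simp
  qed
  with HU show "?H = Units R" by blast
qed

theorem mainTheorem1:
  fixes n :: nat
    and F I :: "((nat \<Rightarrow>\<^sub>0 nat) \<Rightarrow>\<^sub>0 int) set"
    and R :: "((nat \<Rightarrow>\<^sub>0 nat) \<Rightarrow>\<^sub>0 int) set ring"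
  assumes "finite F" and "F \<subseteq> carrier (int_mpoly_ring n)"
    and "I = genideal (int_mpoly_ring n) F"
    and "R = int_mpoly_ring n Quot I"
    and "finite_Z_algebra R"
  shows "(\<exists>s\<ge>1. ideal_power R (nilradical R) s = {\<zero>\<^bsub>R\<^esub>}) \<and>
    (\<forall>G. unit_group_algorithm_returns R G \<longrightarrow>
      set G \<subseteq> Units R \<and> generate (units_of R) (set G) = Units R)"
proof -
  interpret cring R using assms(5) by (simp add: finite_Z_algebra_def)
  let ?N = "nilradical R" and ?s = "nilpotency_index R (nilradical R)"
  have ex: "\<exists>s\<ge>1. ideal_power R ?N s = {\<zero>\<^bsub>R\<^esub>}" by (rule nilradical_nilpotent[OF assms(5)])
  then have s: "1 \<le> ?s \<and> ideal_power R ?N ?s = {\<zero>\<^bsub>R\<^esub>}"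
    unfolding nilpotency_index_def by (rule LeastI_ex)
  have "set G \<subseteq> Units R \<and> generate (units_of R) (set G) = Units R"
    if alg: "unit_group_algorithm_returns R G" for G
  proof -
    obtain us fs where us: "residues_generate R ?N us (Units (R Quot ?N))"
      and fs: "\<forall>i\<in>{2..?s}. residues_generate R (ideal_power R ?N i) (fs i)
        ((\<lambda>a. ideal_power R ?N i +>\<^bsub>R\<^esub> (\<one>\<^bsub>R\<^esub> \<oplus>\<^bsub>R\<^esub> a)) ` ideal_power R ?N (i - 1))"
      and G: "G = us @ concat (map fs [2..<Suc ?s])"
      using alg unfolding unit_group_algorithm_returns_def Let_def by blast
    have "set G = set us \<union> (\<Union>i\<in>{2..?s}. set (fs i))" unfolding G by auto
    with units_generated_by_filtration[of ?s us fs] s us fs show ?thesis by simp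
  qed
  with ex show ?thesis by blast
qed

end
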